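(* Let $X$ be a real vector space ordered by an Archimedean cone $K$. If $U$ is a nonempty subset of $K$ which is order-convex and strictly positively-homogeneous, then the following six properties of $U$ are equivalent: upper self-complete; lower self-complete; self-complete; quasi upper self-complete; quasi lower self-complete; quasi self-complete (i.e. both quasi upper and quasi lower self-complete).
   Context: A cone $K$ in a real vector space $X$ is a nonempty subset with $K+K\subset K$, $tK\subset K$ for all $t\ge 0$, and $K\cap(-K)=\{0\}$; it induces the order $x\le y\iff y-x\in K$. $K$ is Archimedean if ($nx\le y$ for all $n\in\mathbb{N}$) implies $x\le 0$. $U$ is order-convex if $\{z: x\le z\le y\}\subset U$ for all $x,y\in U$; $U$ is strictly positively-homogeneous if $tU\subset U$ for all $t>0$. A sequence $(x_n)$ in $K$ is upper self-bounded if for every $\lambda>1$ there is $k\in\mathbb{N}$ with $x_n\le\lambda x_k$ for all $n\ge k$; lower self-bounded if for every $\mu\in(0,1)$ there is $k\in\mathbb{N}$ with $x_n\ge\mu x_k$ for all $n\ge k$; self-bounded if both. A nonempty subset $U$ of $K$ is upper self-complete if every increasing self-bounded sequence $(x_n)$ in $U$ has a supremum in $X$ and $\sup_n x_n\in U$; lower self-complete if every decreasing self-bounded sequence $(x_n)$ in $U$ has an infimum in $X$ and $\inf_n x_n\in U$; self-complete if it is both. $U$ is quasi upper (resp. quasi lower) self-complete if the supremum (resp. infimum) in the corresponding definition exists in $X$ but is not required to belong to $U$. *)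

theory Defs
  imports Complex_Main
begin

definition order_cone :: "'a::real_vector set \<Rightarrow> bool" where
  "order_cone K \<longleftrightarrow>
     K \<noteq> {} \<and>
     (\<forall>x\<in>K. \<forall>y\<in>K. x + y \<in> K) \<and>
     (\<forall>t\<ge>0. \<forall>x\<in>K. t *\<^sub>R x \<in> K) \<and>
     K \<inter> uminus ` K = {0}"

definition cone_le :: "'a::real_vector set \<Rightarrow> 'a \<Rightarrow> 'a \<Rightarrow> bool" where
  "cone_le K x y \<longleftrightarrow> y - x \<in> K"

text \<open>Including \<open>n = 0\<close> (that is, \<open>0 \<le> y\<close>) in the hypothesis is harmless: for a cone,
  if \<open>n x \<le> y\<close> for all \<open>n \<ge> 1\<close>, then \<open>n x \<le> y - x\<close> for all \<open>n \<ge> 0\<close>.\<close>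

definition archimedean_cone :: "'a::real_vector set \<Rightarrow> bool" where
  "archimedean_cone K \<longleftrightarrow>
     order_cone K \<and>
     (\<forall>x y. (\<forall>n::nat. cone_le K (real n *\<^sub>R x) y) \<longrightarrow> cone_le K x 0)"

definition order_convex :: "'a::real_vector set \<Rightarrow> 'a set \<Rightarrow> bool" where
  "order_convex K U \<longleftrightarrow> (\<forall>x\<in>U. \<forall>y\<in>U. {z. cone_le K x z \<and> cone_le K z y} \<subseteq> U)"

definition strictly_pos_homogeneous :: "'a::real_vector set \<Rightarrow> bool" where
  "strictly_pos_homogeneous U \<longleftrightarrow> (\<forall>t>0. (\<lambda>x. t *\<^sub>R x) ` U \<subseteq> U)"

definition is_supremum :: "'a::real_vector set \<Rightarrow> 'a set \<Rightarrow> 'a \<Rightarrow> bool" where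
  "is_supremum K A s \<longleftrightarrow>
     (\<forall>a\<in>A. cone_le K a s) \<and> (\<forall>b. (\<forall>a\<in>A. cone_le K a b) \<longrightarrow> cone_le K s b)"

definition is_infimum :: "'a::real_vector set \<Rightarrow> 'a set \<Rightarrow> 'a \<Rightarrow> bool" where
  "is_infimum K A s \<longleftrightarrow>
     (\<forall>a\<in>A. cone_le K s a) \<and> (\<forall>b. (\<forall>a\<in>A. cone_le K b a) \<longrightarrow> cone_le K b s)"

text \<open>Self-boundedness is meant for sequences in \<open>K\<close>; below it is only applied to
  sequences in a subset \<open>U\<close> of \<open>K\<close>.\<close>

definition upper_self_bounded :: "'a::real_vector set \<Rightarrow> (nat \<Rightarrow> 'a) \<Rightarrow> bool" where
  "upper_self_bounded K x \<longleftrightarrow>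
     (\<forall>l::real. l > 1 \<longrightarrow> (\<exists>k. \<forall>n\<ge>k. cone_le K (x n) (l *\<^sub>R x k)))"

definition lower_self_bounded :: "'a::real_vector set \<Rightarrow> (nat \<Rightarrow> 'a) \<Rightarrow> bool" where
  "lower_self_bounded K x \<longleftrightarrow>
     (\<forall>m::real. 0 < m \<and> m < 1 \<longrightarrow> (\<exists>k. \<forall>n\<ge>k. cone_le K (m *\<^sub>R x k) (x n)))"

definition self_bounded :: "'a::real_vector set \<Rightarrow> (nat \<Rightarrow> 'a) \<Rightarrow> bool" where
  "self_bounded K x \<longleftrightarrow> upper_self_bounded K x \<and> lower_self_bounded K x"

abbreviation increasing_seq :: "'a::real_vector set \<Rightarrow> (nat \<Rightarrow> 'a) \<Rightarrow> bool" where
  "increasing_seq K x \<equiv> monotone (\<le>) (cone_le K) x"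

abbreviation decreasing_seq :: "'a::real_vector set \<Rightarrow> (nat \<Rightarrow> 'a) \<Rightarrow> bool" where
  "decreasing_seq K x \<equiv> monotone (\<le>) (\<lambda>a b. cone_le K b a) x"

definition upper_self_complete :: "'a::real_vector set \<Rightarrow> 'a set \<Rightarrow> bool" where
  "upper_self_complete K U \<longleftrightarrow>
     (\<forall>x. range x \<subseteq> U \<and> increasing_seq K x \<and> self_bounded K x \<longrightarrow>
        (\<exists>s. is_supremum K (range x) s \<and> s \<in> U))"

definition lower_self_complete :: "'a::real_vector set \<Rightarrow> 'a set \<Rightarrow> bool" where
  "lower_self_complete K U \<longleftrightarrow>
     (\<forall>x. range x \<subseteq> U \<and> decreasing_seq K x \<and> self_bounded K x \<longrightarrow>
        (\<exists>s. is_infimum K (range x) s \<and> s \<in> U))"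

definition self_complete :: "'a::real_vector set \<Rightarrow> 'a set \<Rightarrow> bool" where
  "self_complete K U \<longleftrightarrow> upper_self_complete K U \<and> lower_self_complete K U"

definition quasi_upper_self_complete :: "'a::real_vector set \<Rightarrow> 'a set \<Rightarrow> bool" where
  "quasi_upper_self_complete K U \<longleftrightarrow>
     (\<forall>x. range x \<subseteq> U \<and> increasing_seq K x \<and> self_bounded K x \<longrightarrow>
        (\<exists>s. is_supremum K (range x) s))"

definition quasi_lower_self_complete :: "'a::real_vector set \<Rightarrow> 'a set \<Rightarrow> bool" where
  "quasi_lower_self_complete K U \<longleftrightarrow>
     (\<forall>x. range x \<subseteq> U \<and> decreasing_seq K x \<and> self_bounded K x \<longrightarrow>
        (\<exists>s. is_infimum K (range x) s))"

definition quasi_self_complete :: "'a::real_vector set \<Rightarrow> 'a set \<Rightarrow> bool" where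
  "quasi_self_complete K U \<longleftrightarrow> quasi_upper_self_complete K U \<and> quasi_lower_self_complete K U"

end

theory Submission imports Defs begin

text \<open>
  A self-bounded sequence \<open>x\<close> is reflected to \<open>\<lambda>n. a - x n\<close>, which exchanges increasing with
  decreasing and suprema with infima. If \<open>a = c u\<close> with \<open>u\<close> a suitable term of \<open>x\<close> and \<open>c\<close> large
  enough, all reflected terms lie between multiples of \<open>u\<close>, hence in \<open>U\<close>, and the lower bound
  \<open>u \<le> a - x n\<close> makes the reflected sequence self-bounded as well. A supremum or infimum of a
  self-bounded monotone sequence in \<open>U\<close> lies between multiples of terms of the sequence, hence
  is automatically in \<open>U\<close>.
\<close>

section \<open>Arithmetic of the order induced by a cone\<close>

lemma order_cone_add: "order_cone K \<Longrightarrow> x \<in> K \<Longrightarrow> y \<in> K \<Longrightarrow> x + y \<in> K"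
  by (simp add: order_cone_def)

lemma order_cone_scaleR: "order_cone K \<Longrightarrow> 0 \<le> t \<Longrightarrow> x \<in> K \<Longrightarrow> t *\<^sub>R x \<in> K"
  by (simp add: order_cone_def)

lemma cone_le_refl: "order_cone K \<Longrightarrow> cone_le K x x"
  by (auto simp: order_cone_def cone_le_def)

lemma cone_le_trans:
  assumes "order_cone K" "cone_le K x y" "cone_le K y z"
  shows "cone_le K x z"
  using order_cone_add[OF assms(1), of "y - x" "z - y"] assms(2,3) by (simp add: cone_le_def)

lemma cone_le_scaleR_right:
  assumes "order_cone K" "0 \<le> t" "cone_le K x y"
  shows "cone_le K (t *\<^sub>R x) (t *\<^sub>R y)"
  using order_cone_scaleR[OF assms(1,2), of "y - x"] assms(3)
  by (simp add: cone_le_def scaleR_diff_right)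

lemma cone_le_scaleR_left:
  assumes "order_cone K" "s \<le> t" "x \<in> K"
  shows "cone_le K (s *\<^sub>R x) (t *\<^sub>R x)"
  using order_cone_scaleR[OF assms(1), of "t - s" x] assms(2,3)
  by (simp add: cone_le_def scaleR_diff_left)

section \<open>Reflection in a point: inequalities, suprema and infima\<close>

lemma cone_le_reflect: "cone_le K (a - x) (a - y) \<longleftrightarrow> cone_le K y x"
  by (simp add: cone_le_def)

lemma cone_le_reflect_left: "cone_le K (a - x) y \<longleftrightarrow> cone_le K (a - y) x"
  by (simp add: cone_le_def algebra_simps)

lemma cone_le_reflect_right: "cone_le K x (a - y) \<longleftrightarrow> cone_le K y (a - x)"
  by (simp add: cone_le_def algebra_simps)

text \<open>The map \<open>z \<mapsto> a - z\<close> is an order-reversing involution, so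
  \<open>b\<close> is a lower bound of \<open>x\<close> exactly when \<open>a - b\<close> is an
  upper bound of the reflected sequence.\<close>

lemma is_infimum_reflect:
  assumes "is_supremum K (range (\<lambda>n. a - x n)) s"
  shows "is_infimum K (range x) (a - s)"
  unfolding is_infimum_def
proof (intro conjI allI impI ballI)
  fix y assume "y \<in> range x"
  then show "cone_le K (a - s) y"
    using assms by (auto simp: is_supremum_def cone_le_reflect_left)
next
  fix b assume "\<forall>y\<in>range x. cone_le K b y"
  then have "\<forall>y\<in>range (\<lambda>n. a - x n). cone_le K y (a - b)"
    by (auto simp: cone_le_reflect)
  then show "cone_le K b (a - s)"
    using assms by (simp add: is_supremum_def cone_le_reflect_right[of K b])
qed

lemma is_supremum_reflect:
  assumes "is_infimum K (range (\<lambda>n. a - x n)) s"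
  shows "is_supremum K (range x) (a - s)"
  unfolding is_supremum_def
proof (intro conjI allI impI ballI)
  fix y assume "y \<in> range x"
  then show "cone_le K y (a - s)"
    using assms by (auto simp: is_infimum_def cone_le_reflect_right[of K _ a s])
next
  fix b assume "\<forall>y\<in>range x. cone_le K y b"
  then have "\<forall>y\<in>range (\<lambda>n. a - x n). cone_le K (a - b) y"
    by (auto simp: cone_le_reflect)
  then show "cone_le K (a - s) b"
    using assms by (simp add: is_infimum_def cone_le_reflect_left[of K a s])
qed

lemma order_convexD:
  "order_convex K U \<Longrightarrow> x \<in> U \<Longrightarrow> y \<in> U \<Longrightarrow> cone_le K x z \<Longrightarrow> cone_le K z y \<Longrightarrow> z \<in> U"
  by (auto simp: order_convex_def)

lemma strictly_pos_homogeneousD: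
  "strictly_pos_homogeneous U \<Longrightarrow> 0 < t \<Longrightarrow> x \<in> U \<Longrightarrow> t *\<^sub>R x \<in> U"
  by (auto simp: strictly_pos_homogeneous_def)

section \<open>Self-boundedness of monotone sequences\<close>

lemma increasing_lower_self_bounded:
  assumes "order_cone K" "range x \<subseteq> K" "increasing_seq K x"
  shows "lower_self_bounded K x"
  unfolding lower_self_bounded_def
proof (intro allI impI exI)
  \<comment> \<open>The index left open by \<open>exI\<close> becomes 0 through
    \<open>0 \<le> n\<close>. It serves for every \<open>m\<close>, since
    \<open>m *\<^sub>R x 0\<close> lies below \<open>x 0\<close>, the least term.\<close>
  fix m :: real and n :: nat assume "0 < m \<and> m < 1" "0 \<le> n"
  moreover have "x 0 \<in> K" using assms(2) by auto
  ultimately have "cone_le K (m *\<^sub>R x 0) (x 0)"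
    using cone_le_scaleR_left[OF assms(1), of m 1 "x 0"] by simp
  then show "cone_le K (m *\<^sub>R x 0) (x n)"
    using monotoneD[OF assms(3) \<open>0 \<le> n\<close>] cone_le_trans[OF assms(1)] by blast
qed

lemma decreasing_upper_self_bounded:
  assumes "order_cone K" "range x \<subseteq> K" "decreasing_seq K x"
  shows "upper_self_bounded K x"
  unfolding upper_self_bounded_def
proof (intro allI impI exI)
  fix l :: real and n :: nat assume "1 < l" "0 \<le> n"
  moreover have "x 0 \<in> K" using assms(2) by auto
  ultimately have "cone_le K (x 0) (l *\<^sub>R x 0)"
    using cone_le_scaleR_left[OF assms(1), of 1 l "x 0"] by simp
  then show "cone_le K (x n) (l *\<^sub>R x 0)"
    using monotoneD[OF assms(3) \<open>0 \<le> n\<close>] cone_le_trans[OF assms(1)] by blast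
qed

text \<open>Monotonicity extends the bound to the indices before \<open>k\<close>: compare
  \<open>x n\<close> with the later term at \<open>max n k\<close>.\<close>

lemma increasing_upper_self_bounded_bound:
  assumes "order_cone K" "increasing_seq K x" "upper_self_bounded K x" "1 < l"
  shows "\<exists>k. \<forall>n. cone_le K (x n) (l *\<^sub>R x k)"
proof -
  obtain k where k: "\<And>n. n \<ge> k \<Longrightarrow> cone_le K (x n) (l *\<^sub>R x k)"
    using assms(3,4) by (auto simp: upper_self_bounded_def)
  have "cone_le K (x n) (l *\<^sub>R x k)" for n
    by (rule cone_le_trans[OF assms(1) monotoneD[OF assms(2), of n "max n k"] k]) auto
  then show ?thesis by blast
qed

lemma decreasing_lower_self_bounded_bound:
  assumes "order_cone K" "decreasing_seq K x" "lower_self_bounded K x" "0 < m" "m < 1"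
  shows "\<exists>k. \<forall>n. cone_le K (m *\<^sub>R x k) (x n)"
proof -
  obtain k where k: "\<And>n. n \<ge> k \<Longrightarrow> cone_le K (m *\<^sub>R x k) (x n)"
    using assms(3-5) by (auto simp: lower_self_bounded_def)
  have "cone_le K (m *\<^sub>R x k) (x n)" for n
    by (rule cone_le_trans[OF assms(1) k monotoneD[OF assms(2), of n "max n k"]]) auto
  then show ?thesis by blast
qed

section \<open>Self-boundedness under reflection\<close>

text \<open>The index \<open>k\<close> that serves \<open>x\<close> with factor \<open>m\<close>
  serves the reflected sequence with factor \<open>l\<close>. The error
  \<open>(1 - m) *\<^sub>R x k\<close> is at most \<open>(1 - m) *\<^sub>R u\<close>, and the
  surplus \<open>(l - 1) *\<^sub>R (a - x k)\<close> absorbs it because \<open>a - x k\<close>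
  dominates \<open>u\<close>.\<close>

lemma upper_self_bounded_reflect:
  assumes K: "order_cone K" and u: "u \<in> K"
    and ge: "\<And>n. cone_le K u (a - x n)" and le: "\<And>n. cone_le K (x n) u"
    and lsb: "lower_self_bounded K x"
  shows "upper_self_bounded K (\<lambda>n. a - x n)"
  unfolding upper_self_bounded_def
proof (intro allI impI)
  fix l :: real assume l: "1 < l"
  \<comment> \<open>Absorbing the error requires 1 - m \<le> l - 1, that is m \<ge> 2 - l. The
    maximum with 1/2 keeps \<open>m\<close> positive when l \<ge> 2.\<close>
  define m where "m = max (1/2) (2 - l)"
  have m: "0 < m" "m < 1" "1 - m \<le> l - 1" using l by (auto simp: m_def)
  obtain k where k: "\<And>n. n \<ge> k \<Longrightarrow> cone_le K (m *\<^sub>R x k) (x n)"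
    using lsb m(1,2) by (auto simp: lower_self_bounded_def)
  have "cone_le K (a - x n) (l *\<^sub>R (a - x k))" if "n \<ge> k" for n
  proof -
    have "cone_le K ((1 - m) *\<^sub>R x k) ((1 - m) *\<^sub>R u)"
      using m le by (intro cone_le_scaleR_right[OF K]) auto
    also have "cone_le K ((1 - m) *\<^sub>R u) ((l - 1) *\<^sub>R u)"
      using m u by (intro cone_le_scaleR_left[OF K])
    also (cone_le_trans[OF K]) have "cone_le K ((l - 1) *\<^sub>R u) ((l - 1) *\<^sub>R (a - x k))"
      using l ge by (intro cone_le_scaleR_right[OF K]) auto
    finally (cone_le_trans[OF K]) have "(l - 1) *\<^sub>R (a - x k) - (1 - m) *\<^sub>R x k \<in> K"
      by (simp add: cone_le_def)
    moreover have "x n - m *\<^sub>R x k \<in> K" using k[OF that] by (simp add: cone_le_def)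
    moreover have "l *\<^sub>R (a - x k) - (a - x n)
        = ((l - 1) *\<^sub>R (a - x k) - (1 - m) *\<^sub>R x k) + (x n - m *\<^sub>R x k)"
      by (simp add: algebra_simps)
    ultimately show ?thesis
      unfolding cone_le_def by (metis order_cone_add[OF K])
  qed
  then show "\<exists>k. \<forall>n\<ge>k. cone_le K (a - x n) (l *\<^sub>R (a - x k))" by blast
qed

lemma lower_self_bounded_reflect:
  assumes K: "order_cone K"
    and ge: "\<And>n. cone_le K u (a - x n)" and le: "\<And>n. cone_le K (x n) (2 *\<^sub>R u)"
    and usb: "upper_self_bounded K x"
  shows "lower_self_bounded K (\<lambda>n. a - x n)"
  unfolding lower_self_bounded_def
proof (intro allI impI)
  fix m :: real assume m: "0 < m \<and> m < 1"
  \<comment> \<open>The excess \<open>l - 1\<close> is half of \<open>1 - m\<close> to offset the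
    factor 2 in the bound of \<open>x k\<close> by \<open>2 *\<^sub>R u\<close>.\<close>
  define l where "l = 1 + (1 - m) / 2"
  have l: "1 < l" "(l - 1) * 2 = 1 - m" using m by (auto simp: l_def)
  obtain k where k: "\<And>n. n \<ge> k \<Longrightarrow> cone_le K (x n) (l *\<^sub>R x k)"
    using usb l(1) by (auto simp: upper_self_bounded_def)
  have "cone_le K (m *\<^sub>R (a - x k)) (a - x n)" if "n \<ge> k" for n
  proof -
    have "cone_le K ((l - 1) *\<^sub>R x k) ((l - 1) *\<^sub>R (2 *\<^sub>R u))"
      using l le by (intro cone_le_scaleR_right[OF K]) auto
    also have "(l - 1) *\<^sub>R (2 *\<^sub>R u) = (1 - m) *\<^sub>R u"
      using l(2) by simp
    also have "cone_le K ((1 - m) *\<^sub>R u) ((1 - m) *\<^sub>R (a - x k))"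
      using m ge by (intro cone_le_scaleR_right[OF K]) auto
    finally (cone_le_trans[OF K]) have "(1 - m) *\<^sub>R (a - x k) - (l - 1) *\<^sub>R x k \<in> K"
      by (simp add: cone_le_def)
    moreover have "l *\<^sub>R x k - x n \<in> K" using k[OF that] by (simp add: cone_le_def)
    moreover have "(a - x n) - m *\<^sub>R (a - x k)
        = ((1 - m) *\<^sub>R (a - x k) - (l - 1) *\<^sub>R x k) + (l *\<^sub>R x k - x n)"
      by (simp add: algebra_simps)
    ultimately show ?thesis
      unfolding cone_le_def by (metis order_cone_add[OF K])
  qed
  then show "\<exists>k. \<forall>n\<ge>k. cone_le K (m *\<^sub>R (a - x k)) (a - x n)" by blast
qed

section \<open>Quasi versus full completeness, and passage between upper and lower\<close>

lemma upper_self_complete_iff_quasi: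
  assumes K: "order_cone K" and "order_convex K U" "strictly_pos_homogeneous U"
  shows "upper_self_complete K U \<longleftrightarrow> quasi_upper_self_complete K U"
proof -
  have "s \<in> U" if x: "range x \<subseteq> U" "increasing_seq K x" "self_bounded K x"
    and s: "is_supremum K (range x) s" for x s
  proof -
    have "upper_self_bounded K x" using x(3) by (simp add: self_bounded_def)
    \<comment> \<open>Any factor above 1 would do: the aim is one element of \<open>U\<close> above
      all terms, hence above the supremum.\<close>
    then obtain k where k: "\<And>n. cone_le K (x n) (2 *\<^sub>R x k)"
      using increasing_upper_self_bounded_bound[OF K x(2), of 2] by auto
    have "cone_le K (x 0) s" "cone_le K s (2 *\<^sub>R x k)"
      using s k by (auto simp: is_supremum_def)
    moreover have "x 0 \<in> U" "2 *\<^sub>R x k \<in> U"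
      using x(1) strictly_pos_homogeneousD[OF assms(3), of 2] by auto
    ultimately show ?thesis using order_convexD[OF assms(2)] by blast
  qed
  then show ?thesis
    unfolding upper_self_complete_def quasi_upper_self_complete_def by metis
qed

lemma lower_self_complete_iff_quasi:
  assumes K: "order_cone K" and "order_convex K U" "strictly_pos_homogeneous U"
  shows "lower_self_complete K U \<longleftrightarrow> quasi_lower_self_complete K U"
proof -
  have "s \<in> U" if x: "range x \<subseteq> U" "decreasing_seq K x" "self_bounded K x"
    and s: "is_infimum K (range x) s" for x s
  proof -
    have "lower_self_bounded K x" using x(3) by (simp add: self_bounded_def)
    then obtain k where k: "\<And>n. cone_le K ((1/2) *\<^sub>R x k) (x n)"
      using decreasing_lower_self_bounded_bound[OF K x(2), of "1/2"] by auto
    have "cone_le K s (x 0)" "cone_le K ((1/2) *\<^sub>R x k) s"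
      using s k by (auto simp: is_infimum_def)
    moreover have "x 0 \<in> U" "(1/2) *\<^sub>R x k \<in> U"
      using x(1) strictly_pos_homogeneousD[OF assms(3), of "1/2"] by auto
    ultimately show ?thesis using order_convexD[OF assms(2)] by blast
  qed
  then show ?thesis
    unfolding lower_self_complete_def quasi_lower_self_complete_def by metis
qed

lemma quasi_upper_imp_quasi_lower:
  assumes K: "order_cone K" and UK: "U \<subseteq> K"
    and conv: "order_convex K U" and hom: "strictly_pos_homogeneous U"
    and upper: "quasi_upper_self_complete K U"
  shows "quasi_lower_self_complete K U"
  unfolding quasi_lower_self_complete_def
proof (intro allI impI, elim conjE)
  fix x assume xU: "range x \<subseteq> U" and dec: "decreasing_seq K x" and sb: "self_bounded K x"
  \<comment> \<open>Here \<open>x 0\<close> is the largest term, so 0 \<le> x n \<le> x 0 places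
    every \<open>a - x n\<close> between \<open>x 0\<close> and
    \<open>2 *\<^sub>R x 0\<close>.\<close>
  define a where "a = 2 *\<^sub>R x 0"
  define y where "y n = a - x n" for n
  have xK: "x n \<in> K" for n using xU UK by auto
  have le: "cone_le K (x n) (x 0)" for n using monotoneD[OF dec, of 0 n] by simp
  have ge: "cone_le K (x 0) (y n)" for n
    using le[of n] by (simp add: y_def a_def cone_le_def scaleR_2)
  have "y n \<in> U" for n
  proof (rule order_convexD[OF conv _ _ ge])
    show "x 0 \<in> U" "2 *\<^sub>R x 0 \<in> U"
      using xU strictly_pos_homogeneousD[OF hom, of 2] by auto
    show "cone_le K (y n) (2 *\<^sub>R x 0)"
      using xK by (simp add: y_def a_def cone_le_def)
  qed
  then have yU: "range y \<subseteq> U" by auto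
  have inc: "increasing_seq K y"
    using dec by (auto simp: monotone_def y_def cone_le_reflect)
  \<comment> \<open>This half of self-boundedness comes from the lower self-boundedness of
    \<open>x\<close>; the other half is automatic for an increasing sequence in
    \<open>K\<close>.\<close>
  have "upper_self_bounded K y"
    unfolding y_def using sb xK le ge
    by (intro upper_self_bounded_reflect[OF K, of "x 0"]) (auto simp: self_bounded_def y_def)
  moreover have "lower_self_bounded K y"
    using yU UK by (intro increasing_lower_self_bounded[OF K _ inc]) auto
  ultimately obtain s where "is_supremum K (range y) s"
    using upper yU inc unfolding quasi_upper_self_complete_def self_bounded_def by blast
  then show "\<exists>s. is_infimum K (range x) s"
    unfolding y_def by (blast dest: is_infimum_reflect)
qed

text \<open>An increasing sequence need not have a largest term to reflect in; upper
  self-boundedness supplies the substitute \<open>2 *\<^sub>R x k\<close>.\<close>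

lemma quasi_lower_imp_quasi_upper:
  assumes K: "order_cone K" and UK: "U \<subseteq> K"
    and conv: "order_convex K U" and hom: "strictly_pos_homogeneous U"
    and lower: "quasi_lower_self_complete K U"
  shows "quasi_upper_self_complete K U"
  unfolding quasi_upper_self_complete_def
proof (intro allI impI, elim conjE)
  fix x assume xU: "range x \<subseteq> U" and inc: "increasing_seq K x" and sb: "self_bounded K x"
  have "upper_self_bounded K x" using sb by (simp add: self_bounded_def)
  then obtain k where le: "\<And>n. cone_le K (x n) (2 *\<^sub>R x k)"
    using increasing_upper_self_bounded_bound[OF K inc, of 2] by auto
  \<comment> \<open>The coefficient is 3 = 2 + 1: subtracting a term, at most
    \<open>2 *\<^sub>R x k\<close>, still leaves at least \<open>x k\<close>.\<close>
  define a where "a = 3 *\<^sub>R x k"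
  define y where "y n = a - x n" for n
  have xK: "x n \<in> K" for n using xU UK by auto
  have a: "a = x k + 2 *\<^sub>R x k"
    using scaleR_add_left[of 1 2 "x k"] by (simp add: a_def)
  have ge: "cone_le K (x k) (y n)" for n
    using le[of n] by (simp add: y_def a cone_le_def)
  have "y n \<in> U" for n
  proof (rule order_convexD[OF conv _ _ ge])
    show "x k \<in> U" "3 *\<^sub>R x k \<in> U"
      using xU strictly_pos_homogeneousD[OF hom, of 3] by auto
    show "cone_le K (y n) (3 *\<^sub>R x k)"
      using xK by (simp add: y_def a_def cone_le_def)
  qed
  then have yU: "range y \<subseteq> U" by auto
  have dec: "decreasing_seq K y"
    using inc by (auto simp: monotone_def y_def cone_le_reflect)
  have "lower_self_bounded K y"
    unfolding y_def using sb le ge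
    by (intro lower_self_bounded_reflect[OF K, of "x k"]) (auto simp: self_bounded_def y_def)
  moreover have "upper_self_bounded K y"
    using yU UK by (intro decreasing_upper_self_bounded[OF K _ dec]) auto
  ultimately obtain s where "is_infimum K (range y) s"
    using lower yU dec unfolding quasi_lower_self_complete_def self_bounded_def by blast
  then show "\<exists>s. is_supremum K (range x) s"
    unfolding y_def by (blast dest: is_supremum_reflect)
qed

theorem theorem4p7:
  fixes K U :: "'a::real_vector set"
  assumes "archimedean_cone K"
    and "U \<noteq> {}" and "U \<subseteq> K"
    and "order_convex K U"
    and "strictly_pos_homogeneous U"
  shows "(upper_self_complete K U \<longleftrightarrow> lower_self_complete K U) \<and>
    (upper_self_complete K U \<longleftrightarrow> self_complete K U) \<and>
    (upper_self_complete K U \<longleftrightarrow> quasi_upper_self_complete K U) \<and>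
    (upper_self_complete K U \<longleftrightarrow> quasi_lower_self_complete K U) \<and>
    (upper_self_complete K U \<longleftrightarrow> quasi_self_complete K U)"
proof -
  have K: "order_cone K" using assms(1) by (simp add: archimedean_cone_def)
  \<comment> \<open>Each full notion agrees with its quasi version, so linking the two quasi notions
    connects all six properties.\<close>
  have "quasi_upper_self_complete K U \<longleftrightarrow> quasi_lower_self_complete K U"
    using quasi_upper_imp_quasi_lower[OF K assms(3-5)]
      quasi_lower_imp_quasi_upper[OF K assms(3-5)] by blast
  then show ?thesis
    using upper_self_complete_iff_quasi[OF K assms(4,5)]
      lower_self_complete_iff_quasi[OF K assms(4,5)]
    by (auto simp: self_complete_def quasi_self_complete_def)
qed

end
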